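(* Let $(R,M)$ be a finitely stable local ring whose maximal ideal $M$ is regular and stable, and let $R_\infty$ be as defined in the context. Then $R$ is a quadratic ring and $R_\infty$ has at most two maximal ideals.
   Context: All rings are commutative with identity; a local ring is a ring with a unique maximal ideal (not necessarily Noetherian). $Q(R)$ is the total ring of quotients, $\operatorname{Jac} R$ the Jacobson radical. An ideal is regular if it contains a nonzerodivisor. A fractional ideal of $R$ is an $R$-submodule $I$ of $Q(R)$ with $bI\subseteq R$ for some nonzerodivisor $b\in R$; it is regular if it contains a nonzerodivisor. For a regular fractional ideal $I$, $E(I)=\{q\in Q(R):qI\subseteq I\}$ (the endomorphism ring of $I$), and $I$ is stable if $I$ is projective as an $E(I)$-module. $R$ is finitely stable if every finitely generated regular ideal of $R$ is stable. An extension $R\subseteq S$ is quadratic if $xy\in xR+yR+R$ for all $x,y\in S$. If $\operatorname{Jac} R$ is regular, define $R_0=R$, $R_i=E(\operatorname{Jac} R_{i-1})$ for $i\ge1$, and $R_\infty=\bigcup_{i\ge1}R_i$ (all inside $Q(R)$). $R$ is a quadratic ring if $R$ is local, its maximal ideal is regular and stable, and $R\subseteq R_\infty$ is a quadratic extension. *)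

theory Defs
  imports Main
begin

text \<open>Convention: the ambient type 'a is the total ring of quotients Q(R) of the
  ring R (a subset of 'a). All fractional ideals, endomorphism rings and the
  rings R_i live inside UNIV :: 'a set.\<close>

definition subring_of :: "'a::comm_ring_1 set \<Rightarrow> bool" where
  "subring_of S \<longleftrightarrow> 0 \<in> S \<and> 1 \<in> S \<and> (\<forall>x\<in>S. \<forall>y\<in>S. x + y \<in> S \<and> x * y \<in> S) \<and> (\<forall>x\<in>S. - x \<in> S)"

definition nzd_in :: "'a::comm_ring_1 set \<Rightarrow> 'a \<Rightarrow> bool" where
  "nzd_in R r \<longleftrightarrow> r \<in> R \<and> (\<forall>x\<in>R. r * x = 0 \<longrightarrow> x = 0)"

definition total_quotient_ring :: "'a::comm_ring_1 set \<Rightarrow> bool" where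
  "total_quotient_ring R \<longleftrightarrow> subring_of R
     \<and> (\<forall>s. nzd_in R s \<longrightarrow> (\<exists>t. s * t = 1))
     \<and> (\<forall>q. \<exists>r s. r \<in> R \<and> nzd_in R s \<and> q * s = r)"

definition ideal_in :: "'a::comm_ring_1 set \<Rightarrow> 'a set \<Rightarrow> bool" where
  "ideal_in S I \<longleftrightarrow> I \<subseteq> S \<and> 0 \<in> I \<and> (\<forall>x\<in>I. \<forall>y\<in>I. x + y \<in> I)
     \<and> (\<forall>r\<in>S. \<forall>x\<in>I. r * x \<in> I)"

definition maximal_ideal :: "'a::comm_ring_1 set \<Rightarrow> 'a set \<Rightarrow> bool" where
  "maximal_ideal S M \<longleftrightarrow> ideal_in S M \<and> M \<noteq> S
     \<and> (\<forall>J. ideal_in S J \<longrightarrow> M \<subseteq> J \<longrightarrow> J = M \<or> J = S)"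

definition local_ring :: "'a::comm_ring_1 set \<Rightarrow> bool" where
  "local_ring S \<longleftrightarrow> subring_of S \<and> (\<exists>!M. maximal_ideal S M)"

definition jac :: "'a::comm_ring_1 set \<Rightarrow> 'a set" where
  "jac S = {x \<in> S. \<forall>M. maximal_ideal S M \<longrightarrow> x \<in> M}"

definition regular :: "'a::comm_ring_1 set \<Rightarrow> bool" where
  "regular I \<longleftrightarrow> (\<exists>q\<in>I. \<forall>x. q * x = 0 \<longrightarrow> x = 0)"

definition fractional_ideal :: "'a::comm_ring_1 set \<Rightarrow> 'a set \<Rightarrow> bool" where
  "fractional_ideal R I \<longleftrightarrow> 0 \<in> I \<and> (\<forall>x\<in>I. \<forall>y\<in>I. x + y \<in> I)
     \<and> (\<forall>r\<in>R. \<forall>x\<in>I. r * x \<in> I) \<and> (\<exists>b. nzd_in R b \<and> (\<forall>x\<in>I. b * x \<in> R))"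

definition Endo :: "'a::comm_ring_1 set \<Rightarrow> 'a set" where
  "Endo I = {q. \<forall>x\<in>I. q * x \<in> I}"

text \<open>I is a projective E-module: the canonical surjection from the free E-module on
  the underlying set of I onto I splits, i.e. there is an E-linear section
  s : I \<rightarrow> (finitely supported functions I \<rightarrow> E).\<close>
definition projective_over :: "'a::comm_ring_1 set \<Rightarrow> 'a set \<Rightarrow> bool" where
  "projective_over E I \<longleftrightarrow> (\<exists>s :: 'a \<Rightarrow> 'a \<Rightarrow> 'a.
      (\<forall>x\<in>I. \<forall>y\<in>I. s (x + y) = (\<lambda>z. s x z + s y z))
    \<and> (\<forall>e\<in>E. \<forall>x\<in>I. s (e * x) = (\<lambda>z. e * s x z))
    \<and> (\<forall>x\<in>I. finite {z. s x z \<noteq> 0} \<and> {z. s x z \<noteq> 0} \<subseteq> I \<and> (\<forall>z. s x z \<in> E)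
           \<and> (\<Sum>z\<in>{z. s x z \<noteq> 0}. s x z * z) = x))"

definition stable :: "'a::comm_ring_1 set \<Rightarrow> bool" where
  "stable I \<longleftrightarrow> projective_over (Endo I) I"

definition fg_ideal :: "'a::comm_ring_1 set \<Rightarrow> 'a set \<Rightarrow> bool" where
  "fg_ideal R I \<longleftrightarrow> (\<exists>F. finite F \<and> F \<subseteq> R
      \<and> I = {(\<Sum>f\<in>F. c f * f) | c. \<forall>f\<in>F. c f \<in> R})"

definition finitely_stable :: "'a::comm_ring_1 set \<Rightarrow> bool" where
  "finitely_stable R \<longleftrightarrow> (\<forall>I. fg_ideal R I \<longrightarrow> regular I \<longrightarrow> stable I)"

definition quadratic_ext :: "'a::comm_ring_1 set \<Rightarrow> 'a set \<Rightarrow> bool" where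
  "quadratic_ext R S \<longleftrightarrow> R \<subseteq> S \<and>
     (\<forall>x\<in>S. \<forall>y\<in>S. \<exists>a\<in>R. \<exists>b\<in>R. \<exists>c\<in>R. x * y = x * a + y * b + c)"

primrec R_seq :: "'a::comm_ring_1 set \<Rightarrow> nat \<Rightarrow> 'a set" where
  "R_seq R 0 = R"
| "R_seq R (Suc i) = Endo (jac (R_seq R i))"

definition R_inf :: "'a::comm_ring_1 set \<Rightarrow> 'a set" where
  "R_inf R = (\<Union>i\<in>{1..}. R_seq R i)"

definition quadratic_ring :: "'a::comm_ring_1 set \<Rightarrow> bool" where
  "quadratic_ring R \<longleftrightarrow> local_ring R
     \<and> (\<forall>M. maximal_ideal R M \<longrightarrow> regular M \<and> stable M)
     \<and> quadratic_ext R (R_inf R)"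

end

theory Submission
  imports Defs
begin

text \<open>
  A finitely generated regular fractional ideal \<open>I\<close> is invertible over \<open>E(I)\<close>. If \<open>x\<close> and \<open>y\<close> are roots
  of monic quadratic polynomials over \<open>R\<close>, then \<open>I = R x + R y + R\<close> has its inverse inside \<open>E(I)\<close>, and
  lying over makes this inverse the unit ideal; so \<open>I\<close> is a ring and \<open>x y \<in> I\<close>. It therefore suffices
  that every element of each \<open>R_i\<close> is such a root, which is shown by induction. If \<open>R_i\<close> is
  local, the elements \<open>x\<close> of \<open>R_{i+1}\<close> are treated by inverting \<open>R x + R\<close>. A second maximal ideal
  in \<open>R_i\<close> forces \<open>Jac R_i = M R_i\<close>, which is invertible, whence \<open>R_{i+1} = R_i\<close>. A third maximal
  ideal never occurs, since it would yield a three-generated fractional ideal that is not stable.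
\<close>

section \<open>Ideals, maximal ideals and units of subrings\<close>

lemma subring_ofD:
  assumes "subring_of S"
  shows "0 \<in> S" "1 \<in> S"
    and "x \<in> S \<Longrightarrow> y \<in> S \<Longrightarrow> x + y \<in> S"
    and "x \<in> S \<Longrightarrow> y \<in> S \<Longrightarrow> x * y \<in> S"
    and "x \<in> S \<Longrightarrow> - x \<in> S"
    and "x \<in> S \<Longrightarrow> y \<in> S \<Longrightarrow> x - y \<in> S"
proof -
  show "x \<in> S \<Longrightarrow> y \<in> S \<Longrightarrow> x - y \<in> S"
    using assms unfolding subring_of_def diff_conv_add_uminus by blast
qed (use assms in \<open>auto simp: subring_of_def\<close>)

lemma subring_sum:
  assumes "subring_of S" and "\<And>z. z \<in> F \<Longrightarrow> f z \<in> S"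
  shows "sum f F \<in> S"
  using assms(2) by (induction F rule: infinite_finite_induct) (auto simp: subring_ofD[OF assms(1)])

lemma ideal_inD:
  assumes "ideal_in S I"
  shows "x \<in> I \<Longrightarrow> x \<in> S" "0 \<in> I"
    and "x \<in> I \<Longrightarrow> y \<in> I \<Longrightarrow> x + y \<in> I"
    and "r \<in> S \<Longrightarrow> x \<in> I \<Longrightarrow> r * x \<in> I"
    and "r \<in> S \<Longrightarrow> x \<in> I \<Longrightarrow> x * r \<in> I"
  using assms by (auto simp: ideal_in_def mult.commute)

lemma ideal_uminus:
  assumes "subring_of S" "ideal_in S I" "x \<in> I"
  shows "- x \<in> I"
  using ideal_inD(4)[OF assms(2), of "- 1" x] subring_ofD[OF assms(1)] assms(3) by simp

lemma ideal_diff: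
  assumes "subring_of S" "ideal_in S I" "x \<in> I" "y \<in> I"
  shows "x - y \<in> I"
  using ideal_inD(3)[OF assms(2) assms(3) ideal_uminus[OF assms(1,2,4)]] by simp

lemma maximal_ideal_one:
  assumes "subring_of S" "maximal_ideal S N"
  shows "1 \<notin> N"
proof
  assume "1 \<in> N"
  then have "S \<subseteq> N"
    using assms(2) ideal_inD(4)[of S N _ 1] by (force simp: maximal_ideal_def)
  then show False
    using assms(2) by (auto simp: maximal_ideal_def ideal_in_def)
qed


lemma maximal_ideal_comaximal:
  assumes S: "subring_of S" and N: "maximal_ideal S N" and J: "ideal_in S J" and "\<not> J \<subseteq> N"
  obtains n j where "n \<in> N" "j \<in> J" "n + j = 1"
proof -
  have NI: "ideal_in S N" using N by (simp add: maximal_ideal_def)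
  note a = ideal_inD[OF NI] and b = ideal_inD[OF J]
  let ?K = "{x + y | x y. x \<in> N \<and> y \<in> J}"
  have "ideal_in S ?K"
    unfolding ideal_in_def
  proof (intro conjI ballI subsetI)
    show "z \<in> S" if "z \<in> ?K" for z
      using that a(1) b(1) subring_ofD(3)[OF S] by blast
    show "0 \<in> ?K" using a(2) b(2) by force
    show "r * z \<in> ?K" if "r \<in> S" "z \<in> ?K" for r z
      using that a(4) b(4) by (fastforce simp: distrib_left)
    show "z + z' \<in> ?K" if z: "z \<in> ?K" "z' \<in> ?K" for z z'
    proof -
      from z obtain x y x' y' where
        "x \<in> N" "y \<in> J" "x' \<in> N" "y' \<in> J" "z = x + y" "z' = x' + y'" by blast
      then have "x + x' \<in> N" "y + y' \<in> J" "z + z' = (x + x') + (y + y')"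
        using a(3) b(3) by (auto simp: algebra_simps)
      then show ?thesis by blast
    qed
  qed
  moreover have "N \<subseteq> ?K" using b(2) by force
  moreover have "J \<subseteq> ?K" using a(2) by force
  moreover have "K = S" if "ideal_in S K" "N \<subseteq> K" "J \<subseteq> K" for K
    using that N assms(4) unfolding maximal_ideal_def by blast
  ultimately have "?K = S" by blast
  then have "1 \<in> ?K" using subring_ofD(2)[OF S] by simp
  then show ?thesis using that by force
qed

lemma principal_ideal:
  assumes S: "subring_of S" and x: "x \<in> S"
  shows "ideal_in S {x * s | s. s \<in> S}" "x \<in> {x * s | s. s \<in> S}"
proof -
  let ?J = "{x * s | s. s \<in> S}"
  show "ideal_in S ?J"
    unfolding ideal_in_def
  proof (intro conjI ballI subsetI)
    show "z \<in> S" if "z \<in> ?J" for z using that x subring_ofD(4)[OF S] by auto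
    show "0 \<in> ?J" using subring_ofD(1)[OF S] by force
    show "z + z' \<in> ?J" if z: "z \<in> ?J" "z' \<in> ?J" for z z'
    proof -
      obtain s s' where "s \<in> S" "s' \<in> S" "z + z' = x * (s + s')"
        using z by (auto simp: distrib_left)
      then show ?thesis using subring_ofD(3)[OF S] by blast
    qed
    show "r * z \<in> ?J" if r: "r \<in> S" and z: "z \<in> ?J" for r z
    proof -
      obtain s where "s \<in> S" "r * z = x * (r * s)"
        using z by (auto simp: ac_simps)
      then show ?thesis using r subring_ofD(4)[OF S] by blast
    qed
  qed
  show "x \<in> ?J" using subring_ofD(2)[OF S] by force
qed

lemma maximal_ideal_inverse:
  assumes S: "subring_of S" and N: "maximal_ideal S N" and x: "x \<in> S" "x \<notin> N"
  obtains s where "s \<in> S" "1 - x * s \<in> N"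
proof -
  let ?J = "{x * s | s. s \<in> S}"
  have "ideal_in S ?J" using S x(1) by (rule principal_ideal)
  moreover have "\<not> ?J \<subseteq> N"
    using x subring_ofD(2)[OF S] by force
  ultimately obtain n j where nj: "n \<in> N" "j \<in> ?J" "n + j = 1"
    using maximal_ideal_comaximal[OF S N] by blast
  then obtain s where "s \<in> S" "j = x * s" by blast
  moreover have "n = 1 - j" using nj(3) by (simp add: algebra_simps)
  ultimately show ?thesis using nj(1) that by blast
qed

text \<open>Chinese remainder input: \<open>e\<close> has residue 1 at \<open>N\<close> and 0 at
  \<open>N'\<close>. Products of such elements realise prescribed residues at several maximal
  ideals.\<close>

lemma maximal_ideals_residues:
  assumes S: "subring_of S" and N: "maximal_ideal S N" and N': "maximal_ideal S N'" and "N \<noteq> N'"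
  obtains e where "e \<in> N'" "1 - e \<in> N"
proof -
  have "ideal_in S N'" "\<not> N' \<subseteq> N"
    using N N' assms(4) by (auto simp: maximal_ideal_def)
  then obtain n j where nj: "n \<in> N" "j \<in> N'" "n + j = 1"
    using maximal_ideal_comaximal[OF S N] by metis
  then have "1 - j = n" by (simp add: algebra_simps)
  then show ?thesis using that nj by metis
qed

lemma nonunit_in_maximal_ideal:
  assumes S: "subring_of S" and a: "a \<in> S" and nonunit: "\<And>t. t \<in> S \<Longrightarrow> a * t \<noteq> 1"
  obtains N where "maximal_ideal S N" "a \<in> N"
proof -
  let ?A = "{I. ideal_in S I \<and> a \<in> I \<and> 1 \<notin> I}"
  have "\<exists>N\<in>?A. \<forall>X\<in>?A. N \<subseteq> X \<longrightarrow> X = N"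
  proof (rule subset_Zorn_nonempty)
    let ?P = "{a * s | s. s \<in> S}"
    have "ideal_in S ?P" "a \<in> ?P" using principal_ideal[OF S a] by auto
    moreover have "1 \<notin> ?P" using nonunit by force
    ultimately show "?A \<noteq> {}" by blast
  next
    fix C assume C: "C \<noteq> {}" "subset.chain ?A C"
    have el: "ideal_in S I" "a \<in> I" "1 \<notin> I" if "I \<in> C" for I
      using C(2) that by (auto simp: subset.chain_def)
    have "ideal_in S (\<Union>C)"
      unfolding ideal_in_def
    proof (intro conjI ballI subsetI)
      show "x \<in> S" if "x \<in> \<Union>C" for x using that el(1) ideal_inD(1) by blast
      show "0 \<in> \<Union>C" using C(1) el(1) ideal_inD(2) by blast
      show "r * x \<in> \<Union>C" if "r \<in> S" "x \<in> \<Union>C" for r x using that el(1) ideal_inD(4) by blast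
      show "x + y \<in> \<Union>C" if xy: "x \<in> \<Union>C" "y \<in> \<Union>C" for x y
      proof -
        obtain I J where IJ: "I \<in> C" "J \<in> C" "x \<in> I" "y \<in> J" using xy by blast
        then have "I \<subseteq> J \<or> J \<subseteq> I" using C(2) by (auto simp: subset.chain_def)
        then show ?thesis using IJ el(1) ideal_inD(3) by (metis UnionI subsetD)
      qed
    qed
    then show "\<Union>C \<in> ?A" using C(1) el by blast
  qed
  then obtain N where N: "ideal_in S N" "a \<in> N" "1 \<notin> N"
    and max: "\<And>X. ideal_in S X \<Longrightarrow> a \<in> X \<Longrightarrow> 1 \<notin> X \<Longrightarrow> N \<subseteq> X \<Longrightarrow> X = N" by blast
  have "J = N \<or> J = S" if J: "ideal_in S J" "N \<subseteq> J" for J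
  proof (cases "1 \<in> J")
    case True
    then have "S \<subseteq> J" using ideal_inD(4)[OF J(1)] by force
    then show ?thesis using ideal_inD(1)[OF J(1)] by blast
  next
    case False
    then show ?thesis using max J N(2) by blast
  qed
  then have "maximal_ideal S N"
    using N subring_ofD(2)[OF S] by (auto simp: maximal_ideal_def)
  then show ?thesis using that N(2) by blast
qed

lemma unit_if_not_in_maximal_ideals:
  assumes "subring_of S" "a \<in> S" "\<And>N. maximal_ideal S N \<Longrightarrow> a \<notin> N"
  shows "\<exists>t\<in>S. a * t = 1"
proof (rule ccontr)
  assume "\<not> ?thesis"
  then obtain N where "maximal_ideal S N" "a \<in> N"
    using nonunit_in_maximal_ideal[OF assms(1,2)] by auto
  then show False using assms(3) by blast
qed

lemma jac_ideal:
  assumes "subring_of S"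
  shows "ideal_in S (jac S)"
  unfolding ideal_in_def
proof (intro conjI ballI)
  note ring = subring_ofD[OF assms]
  have N: "ideal_in S N" if "maximal_ideal S N" for N using that by (simp add: maximal_ideal_def)
  show "jac S \<subseteq> S" by (auto simp: jac_def)
  show "0 \<in> jac S" using ring(1) ideal_inD(2)[OF N] by (simp add: jac_def)
  show "x + y \<in> jac S" if "x \<in> jac S" "y \<in> jac S" for x y
    using that ring(3) ideal_inD(3)[OF N] by (simp add: jac_def)
  show "r * x \<in> jac S" if "r \<in> S" "x \<in> jac S" for r x
    using that ring(4) ideal_inD(4)[OF N] by (simp add: jac_def)
qed

section \<open>Submodules of the total quotient ring, endomorphism rings and invertibility\<close>

definition submodule :: "'a::comm_ring_1 set \<Rightarrow> 'a set \<Rightarrow> bool" where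
  "submodule R I \<longleftrightarrow> 0 \<in> I \<and> (\<forall>x\<in>I. \<forall>y\<in>I. x + y \<in> I) \<and> (\<forall>r\<in>R. \<forall>x\<in>I. r * x \<in> I)"

lemma submoduleD:
  assumes "submodule R I"
  shows "0 \<in> I" "x \<in> I \<Longrightarrow> y \<in> I \<Longrightarrow> x + y \<in> I" "r \<in> R \<Longrightarrow> x \<in> I \<Longrightarrow> r * x \<in> I"
  using assms by (auto simp: submodule_def)

lemma ideal_in_submodule: "ideal_in S I \<Longrightarrow> submodule S I"
  by (auto simp: ideal_in_def submodule_def)

lemma Endo_subring:
  assumes "subring_of R" "submodule R I"
  shows "subring_of (Endo I)" "R \<subseteq> Endo I"
proof -
  note I = submoduleD[OF assms(2)]
  have neg: "- x \<in> I" if "x \<in> I" for x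
    using I(3)[of "- 1" x] subring_ofD[OF assms(1)] that by simp
  show "subring_of (Endo I)"
    unfolding subring_of_def Endo_def using I(1,2) neg
    by (auto simp: distrib_right mult.assoc)
  show "R \<subseteq> Endo I" using I(3) by (auto simp: Endo_def)
qed

lemma total_quotient_ring_denominator:
  fixes R :: "'a::comm_ring_1 set" and q :: 'a
  assumes "total_quotient_ring R"
  obtains d t where "nzd_in R d" "d * t = 1" "d * q \<in> R"
proof -
  obtain r d where "r \<in> R" "nzd_in R d" "q * d = r"
    using assms unfolding total_quotient_ring_def by blast
  moreover from this obtain t where "d * t = 1"
    using assms unfolding total_quotient_ring_def by blast
  ultimately show ?thesis using that[of d t] by (simp add: mult.commute)
qed

text \<open>Clearing the denominator of \<open>r\<close> yields a nonzerodivisor of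
  \<open>R\<close>, which is a unit of the ambient ring by assumption.\<close>

lemma nonzerodivisor_unit:
  fixes R :: "'a::comm_ring_1 set" and r :: 'a
  assumes R: "total_quotient_ring R" and r: "\<And>x. r * x = 0 \<Longrightarrow> x = 0"
  obtains t where "r * t = 1"
proof -
  obtain d t where d: "nzd_in R d" "d * t = 1" "d * r \<in> R"
    using total_quotient_ring_denominator[OF R] .
  have "x = 0" if "d * r * x = 0" for x
  proof -
    have "r * x = (d * t) * (r * x)" using d(2) by simp
    also have "\<dots> = t * (d * r * x)" by (simp add: ac_simps)
    finally show ?thesis using that r by simp
  qed
  then have "nzd_in R (d * r)" using d(3) by (auto simp: nzd_in_def)
  then obtain u where "d * r * u = 1" using R unfolding total_quotient_ring_def by blast
  then have "r * (d * u) = 1" by (simp add: ac_simps)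
  then show ?thesis using that by blast
qed

text \<open>A coordinate functional of a splitting is multiplication by its value at a regular
  element \<open>r\<close> divided by \<open>r\<close>; so a stable regular \<open>I\<close> is invertible over its endomorphism ring.\<close>

lemma stable_regular_invertible:
  assumes R: "total_quotient_ring R" and I: "submodule R I" "regular I" "stable I"
  obtains F b where "finite F" "F \<subseteq> I" "\<And>z u. u \<in> I \<Longrightarrow> b z * u \<in> Endo I"
    "(\<Sum>z\<in>F. b z * z) = 1"
proof -
  have sR: "subring_of R" using R by (simp add: total_quotient_ring_def)
  note E = Endo_subring[OF sR I(1)]
  obtain s :: "'a \<Rightarrow> 'a \<Rightarrow> 'a" where
    s: "\<forall>e\<in>Endo I. \<forall>x\<in>I. s (e * x) = (\<lambda>z. e * s x z)"
       "\<forall>x\<in>I. finite {z. s x z \<noteq> 0} \<and> {z. s x z \<noteq> 0} \<subseteq> I \<and> (\<forall>z. s x z \<in> Endo I)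
         \<and> (\<Sum>z\<in>{z. s x z \<noteq> 0}. s x z * z) = x"
    using I(3) unfolding stable_def projective_over_def by blast
  have hom: "s (e * x) z = e * s x z" if "e \<in> Endo I" "x \<in> I" for e x z using s(1) that by simp
  have fin: "finite {z. s x z \<noteq> 0}" and supp: "{z. s x z \<noteq> 0} \<subseteq> I" and val: "s x z \<in> Endo I"
    and id: "(\<Sum>z\<in>{z. s x z \<noteq> 0}. s x z * z) = x" if "x \<in> I" for x z using s(2) that by auto
  obtain r where r: "r \<in> I" "\<And>x. r * x = 0 \<Longrightarrow> x = 0"
    using I(2) by (auto simp: regular_def)
  obtain t where t: "r * t = 1" using nonzerodivisor_unit[OF R r(2)] .
  define b where "b z = t * s r z" for z
  have "b z * u \<in> Endo I" if u: "u \<in> I" for z u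
  proof -
    \<comment> \<open>Multiplication by \<open>t * u\<close> need not preserve \<open>I\<close>.
      After clearing its denominator the multiplier lies in \<open>R\<close>, so linearity of
      \<open>s\<close> applies, and cancelling \<open>d\<close> gives
      \<open>b z * u = s u z\<close>.\<close>
    obtain d d' where d: "nzd_in R d" "d * d' = 1" "d * (t * u) \<in> R"
      using total_quotient_ring_denominator[OF R] .
    have dR: "d \<in> R" using d(1) by (simp add: nzd_in_def)
    have "d * (b z * u) = (d * (t * u)) * s r z" by (simp add: b_def ac_simps)
    also have "\<dots> = s ((d * (t * u)) * r) z" using hom d(3) r(1) E(2) by (metis subsetD)
    also have "(d * (t * u)) * r = d * u" using t by (metis mult.commute mult.left_commute mult_1)
    also have "s (d * u) z = d * s u z" using hom dR u E(2) by blast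
    finally have "d' * (d * (b z * u)) = d' * (d * s u z)" by simp
    then have "b z * u = s u z" using d(2) by (metis mult.assoc mult.commute mult_1)
    then show ?thesis using val u by simp
  qed
  moreover have "(\<Sum>z\<in>{z. s r z \<noteq> 0}. b z * z) = t * (\<Sum>z\<in>{z. s r z \<noteq> 0}. s r z * z)"
    by (simp add: b_def sum_distrib_left mult.assoc)
  then have "(\<Sum>z\<in>{z. s r z \<noteq> 0}. b z * z) = 1"
    using id[OF r(1)] t by (simp add: mult.commute)
  ultimately show ?thesis using that fin[OF r(1)] supp[OF r(1)] by blast
qed

section \<open>Three-generated fractional ideals\<close>

text \<open>The third generator is chosen as 1 for products of quadratic elements, as a regular
  element of \<open>M\<close> for counting maximal ideals, and as 0 for the two-generated ideal
  \<open>R x + R\<close>.\<close>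

definition span3 :: "'a::comm_ring_1 set \<Rightarrow> 'a \<Rightarrow> 'a \<Rightarrow> 'a \<Rightarrow> 'a set" where
  "span3 R x y w = {a * x + b * y + c * w | a b c. a \<in> R \<and> b \<in> R \<and> c \<in> R}"

lemma span3I: "a \<in> R \<Longrightarrow> b \<in> R \<Longrightarrow> c \<in> R \<Longrightarrow> a * x + b * y + c * w \<in> span3 R x y w"
  by (auto simp: span3_def)

lemma span3E:
  assumes "z \<in> span3 R x y w"
  obtains a b c where "a \<in> R" "b \<in> R" "c \<in> R" "z = a * x + b * y + c * w"
  using assms by (auto simp: span3_def)

lemma span3_submodule:
  assumes R: "subring_of R"
  shows "submodule R (span3 R x y w)" "x \<in> span3 R x y w" "y \<in> span3 R x y w" "w \<in> span3 R x y w"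
proof -
  note r = subring_ofD[OF R]
  show "x \<in> span3 R x y w" using span3I[OF r(2,1,1), of x y w] by simp
  show "y \<in> span3 R x y w" using span3I[OF r(1,2,1), of x y w] by simp
  show "w \<in> span3 R x y w" using span3I[OF r(1,1,2), of x y w] by simp
  show "submodule R (span3 R x y w)"
    unfolding submodule_def
  proof (intro conjI ballI)
    show "0 \<in> span3 R x y w" using span3I[OF r(1,1,1), of x y w] by simp
  next
    fix u v assume "u \<in> span3 R x y w" "v \<in> span3 R x y w"
    then obtain a b c a' b' c' where *: "a \<in> R" "b \<in> R" "c \<in> R" "a' \<in> R" "b' \<in> R" "c' \<in> R"
      "u = a * x + b * y + c * w" "v = a' * x + b' * y + c' * w" by (metis span3E)
    then have "u + v = (a + a') * x + (b + b') * y + (c + c') * w" by (simp add: algebra_simps)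
    then show "u + v \<in> span3 R x y w" using * r(3) span3I by metis
  next
    fix k u assume k: "k \<in> R" and "u \<in> span3 R x y w"
    then obtain a b c where *: "a \<in> R" "b \<in> R" "c \<in> R" "u = a * x + b * y + c * w" by (metis span3E)
    then have "k * u = (k * a) * x + (k * b) * y + (k * c) * w" by (simp add: algebra_simps)
    then show "k * u \<in> span3 R x y w" using * k r(4) span3I by metis
  qed
qed

text \<open>The generators in \<open>fg_ideal\<close> form a set, so equal generators collapse.
  Peeling them off one at a time covers that case too: if \<open>g\<close> already lies in
  \<open>F\<close>, its two coefficients are added.\<close>

lemma fg_span_insert:
  assumes R: "subring_of R" and F: "finite F"
  shows "{(\<Sum>f\<in>insert g F. c f * f) | c. \<forall>f\<in>insert g F. c f \<in> R}
       = {a * g + u | a u. a \<in> R \<and> u \<in> {(\<Sum>f\<in>F. c f * f) | c. \<forall>f\<in>F. c f \<in> R}}"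
    (is "?L = ?R")
proof (rule set_eqI)
  fix z
  show "z \<in> ?L \<longleftrightarrow> z \<in> ?R"
  proof (cases "g \<in> F")
    case True
    have "z \<in> ?R" if "z \<in> ?L"
      using that True subring_ofD(1)[OF R] by (force simp: insert_absorb intro: exI[of _ "0::'a"])
    moreover have "z \<in> ?L" if zR: "z \<in> ?R"
    proof -
      obtain a c where ac: "a \<in> R" "\<forall>f\<in>F. c f \<in> R" "z = a * g + (\<Sum>f\<in>F. c f * f)"
        using zR by blast
      let ?c = "c(g := a + c g)"
      have "(\<Sum>f\<in>F. ?c f * f) = (a + c g) * g + (\<Sum>f\<in>F - {g}. c f * f)"
        using F True by (subst sum.remove[of _ g]) (auto intro!: sum.cong)
      also have "\<dots> = a * g + (\<Sum>f\<in>F. c f * f)"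
        using F True by (subst (2) sum.remove[of _ g]) (auto simp: algebra_simps)
      finally have "z = (\<Sum>f\<in>insert g F. ?c f * f)" using ac(3) True by (simp add: insert_absorb)
      moreover have "\<forall>f\<in>insert g F. ?c f \<in> R" using ac True subring_ofD(3)[OF R] by auto
      ultimately show ?thesis by blast
    qed
    ultimately show ?thesis by blast
  next
    case False
    have "z \<in> ?R" if "z \<in> ?L"
      using that False F by auto
    moreover have "z \<in> ?L" if zR: "z \<in> ?R"
    proof -
      obtain a c where ac: "a \<in> R" "\<forall>f\<in>F. c f \<in> R" "z = a * g + (\<Sum>f\<in>F. c f * f)"
        using zR by blast
      have "(\<Sum>f\<in>F. (c(g := a)) f * f) = (\<Sum>f\<in>F. c f * f)"
        using False by (intro sum.cong) auto
      then have "z = (\<Sum>f\<in>insert g F. (c(g := a)) f * f)" using ac(3) False F by simp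
      moreover have "\<forall>f\<in>insert g F. (c(g := a)) f \<in> R" using ac by auto
      ultimately show ?thesis by blast
    qed
    ultimately show ?thesis by blast
  qed
qed

lemma span3_fg_ideal:
  assumes R: "subring_of R" and "x \<in> R" "y \<in> R" "w \<in> R"
  shows "fg_ideal R (span3 R x y w)"
  unfolding fg_ideal_def
proof (intro exI conjI)
  show "finite {x, y, w}" "{x, y, w} \<subseteq> R" using assms by auto
  show "span3 R x y w = {(\<Sum>f\<in>{x, y, w}. c f * f) | c. \<forall>f\<in>{x, y, w}. c f \<in> R}"
    apply (subst fg_span_insert[OF R], simp)
    apply (subst fg_span_insert[OF R], simp)
    apply (subst fg_span_insert[OF R], simp)
    apply (simp add: span3_def add.assoc)
    apply blast
    done
qed

text \<open>Finite stability speaks of ideals inside \<open>R\<close>. This and the next two lemmas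
  transport a fractional ideal there by multiplying with a common denominator
  \<open>d\<close>.\<close>

lemma span3_scale: "span3 R (d * x) (d * y) (d * w) = (*) d ` span3 R x y w"
proof -
  have *: "a * (d * x) + b * (d * y) + c * (d * w) = d * (a * x + b * y + c * w)" for a b c
    by (simp add: algebra_simps)
  show ?thesis unfolding span3_def * by blast
qed

lemma Endo_scale:
  assumes "d * t = 1"
  shows "Endo ((*) d ` I) = Endo I"
proof -
  have inj: "u = v" if "d * u = d * v" for u v
    using that assms by (metis mult.assoc mult.commute mult_1)
  have "q * (d * u) \<in> (*) d ` I \<longleftrightarrow> q * u \<in> I" for q u
    using inj by (auto simp: mult.left_commute[of q d u])
  then show ?thesis by (auto simp: Endo_def)
qed

lemma regular_scale:
  assumes "d * t = 1" "regular I"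
  shows "regular ((*) d ` I)"
proof -
  obtain q where q: "q \<in> I" "\<And>x. q * x = 0 \<Longrightarrow> x = 0" using assms(2) by (auto simp: regular_def)
  have "x = 0" if "d * q * x = 0" for x
  proof -
    have "q * x = t * (d * q * x)" using assms(1) by (metis mult.assoc mult.commute mult_1)
    then show ?thesis using that q(2) by simp
  qed
  then show ?thesis using q(1) by (auto simp: regular_def)
qed

text \<open>Invertibility expressed through the three given generators: scale the span into
  \<open>R\<close>, apply \<open>stable_regular_invertible\<close>, expand each element of
  \<open>F\<close> in the generators and collect. The elements \<open>p\<close>, \<open>q\<close>,
  \<open>r\<close> lie in the inverse of the span over its endomorphism ring.\<close>

lemma finitely_stable_span3:
  assumes R: "total_quotient_ring R" and fs: "finitely_stable R"
    and reg: "regular (span3 R x y w)"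
  obtains p q r where "p * x + q * y + r * w = 1"
    "\<And>u. u \<in> span3 R x y w \<Longrightarrow> p * u \<in> Endo (span3 R x y w)"
    "\<And>u. u \<in> span3 R x y w \<Longrightarrow> q * u \<in> Endo (span3 R x y w)"
    "\<And>u. u \<in> span3 R x y w \<Longrightarrow> r * u \<in> Endo (span3 R x y w)"
proof -
  have sR: "subring_of R" using R by (simp add: total_quotient_ring_def)
  note ring = subring_ofD[OF sR]
  let ?I = "span3 R x y w"
  obtain d1 t1 where d1: "nzd_in R d1" "d1 * t1 = 1" "d1 * x \<in> R"
    using total_quotient_ring_denominator[OF R] .
  obtain d2 t2 where d2: "nzd_in R d2" "d2 * t2 = 1" "d2 * y \<in> R"
    using total_quotient_ring_denominator[OF R] .
  obtain d3 t3 where d3: "nzd_in R d3" "d3 * t3 = 1" "d3 * w \<in> R"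
    using total_quotient_ring_denominator[OF R] .
  define d where "d = d1 * d2 * d3"
  define t where "t = t1 * t2 * t3"
  have "d * t = (d1 * t1) * (d2 * t2) * (d3 * t3)" by (simp add: d_def t_def ac_simps)
  then have dt: "d * t = 1" using d1 d2 d3 by simp
  have dR: "d1 \<in> R" "d2 \<in> R" "d3 \<in> R" using d1 d2 d3 by (auto simp: nzd_in_def)
  have "d * x = d2 * d3 * (d1 * x)" "d * y = d1 * d3 * (d2 * y)" "d * w = d1 * d2 * (d3 * w)"
    by (simp_all add: d_def ac_simps)
  then have dxyw: "d * x \<in> R" "d * y \<in> R" "d * w \<in> R" using dR d1 d2 d3 ring(4) by metis+
  let ?J = "span3 R (d * x) (d * y) (d * w)"
  have J: "?J = (*) d ` ?I" by (rule span3_scale)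
  have EJ: "Endo ?J = Endo ?I" unfolding J by (rule Endo_scale[OF dt])
  have regJ: "regular ?J" unfolding J by (rule regular_scale[OF dt reg])
  have stJ: "stable ?J" using fs regJ span3_fg_ideal[OF sR dxyw] by (auto simp: finitely_stable_def)
  obtain F b where F: "finite F" "F \<subseteq> ?J" "\<And>z u. u \<in> ?J \<Longrightarrow> b z * u \<in> Endo ?J"
      "(\<Sum>z\<in>F. b z * z) = 1"
    using stable_regular_invertible[OF R span3_submodule(1)[OF sR] regJ stJ] by blast
  have "\<forall>z\<in>F. \<exists>\<alpha> \<beta> \<gamma>. \<alpha> \<in> R \<and> \<beta> \<in> R \<and> \<gamma> \<in> R \<and> z = \<alpha> * (d * x) + \<beta> * (d * y) + \<gamma> * (d * w)"
    using F(2) unfolding span3_def by blast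
  then obtain \<alpha> \<beta> \<gamma> where abc: "\<And>z. z \<in> F \<Longrightarrow> \<alpha> z \<in> R" "\<And>z. z \<in> F \<Longrightarrow> \<beta> z \<in> R"
      "\<And>z. z \<in> F \<Longrightarrow> \<gamma> z \<in> R"
      "\<And>z. z \<in> F \<Longrightarrow> z = \<alpha> z * (d * x) + \<beta> z * (d * y) + \<gamma> z * (d * w)" by metis
  note E = Endo_subring[OF sR span3_submodule(1)[OF sR, of x y w]]
  \<comment> \<open>The collected coefficient of one generator stays in the inverse; the factor
    \<open>d\<close> passes from the scaled ideal back to \<open>?I\<close>.\<close>
  have mem: "(\<Sum>z\<in>F. b z * (c z * d)) * u \<in> Endo ?I"
    if c: "\<And>z. z \<in> F \<Longrightarrow> c z \<in> R" and u: "u \<in> ?I" for c u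
  proof -
    have "c z * (b z * (d * u)) \<in> Endo ?I" if "z \<in> F" for z
    proof -
      have "d * u \<in> ?J" using u J by blast
      then have "b z * (d * u) \<in> Endo ?I" using F(3) EJ by simp
      moreover have "c z \<in> Endo ?I" using c that E(2) by blast
      ultimately show ?thesis using subring_ofD(4)[OF E(1)] by blast
    qed
    then have "(\<Sum>z\<in>F. c z * (b z * (d * u))) \<in> Endo ?I" by (rule subring_sum[OF E(1)])
    moreover have "(\<Sum>z\<in>F. b z * (c z * d)) * u = (\<Sum>z\<in>F. c z * (b z * (d * u)))"
      by (subst sum_distrib_right) (simp add: ac_simps)
    ultimately show ?thesis by simp
  qed
  have "1 = (\<Sum>z\<in>F. b z * (\<alpha> z * (d * x) + \<beta> z * (d * y) + \<gamma> z * (d * w)))"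
    using F(4) abc(4) by (metis (no_types, lifting) sum.cong)
  also have "\<dots> = (\<Sum>z\<in>F. b z * (\<alpha> z * d)) * x + (\<Sum>z\<in>F. b z * (\<beta> z * d)) * y
      + (\<Sum>z\<in>F. b z * (\<gamma> z * d)) * w"
    unfolding sum_distrib_right sum.distrib[symmetric]
    by (intro sum.cong) (simp_all add: algebra_simps)
  finally show ?thesis
    using that[OF _ mem[of \<alpha>] mem[of \<beta>] mem[of \<gamma>]] abc(1-3) by simp
qed

section \<open>Quadratic elements and lying over\<close>

definition quadratic_over :: "'a::comm_ring_1 set \<Rightarrow> 'a \<Rightarrow> bool" where
  "quadratic_over R x \<longleftrightarrow> (\<exists>a\<in>R. \<exists>b\<in>R. x * x = a * x + b)"

text \<open>Lying over for one quadratic step \<open>E \<subseteq> E + E y\<close>: if \<open>1 = u + r y\<close> with \<open>u, r\<close> in an ideal,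
  squaring \<open>1 - u = r y\<close> expresses 1 without \<open>y\<close>.\<close>

lemma quadratic_eliminate:
  fixes u r y :: "'a::comm_ring_1"
  assumes "1 = u + r * y" "y * y = b * y + c"
  shows "1 = 2 * u - u * u + r * b * (1 - u) + r * r * c"
proof -
  have "r * y = 1 - u" using assms(1) by (simp add: algebra_simps)
  then have "(1 - u) * (1 - u) = r * r * (y * y)" by (metis mult.assoc mult.left_commute)
  also have "\<dots> = r * b * (r * y) + r * r * c" by (simp add: assms(2) algebra_simps)
  also have "\<dots> = r * b * (1 - u) + r * r * c" using \<open>r * y = 1 - u\<close> by simp
  finally show ?thesis by (simp add: algebra_simps)
qed

text \<open>The ideal \<open>P\<close> becomes the unit ideal after adjoining the integral elements
  \<open>x\<close> and \<open>y\<close>, so it was the unit ideal before. Explicitly,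
  \<open>quadratic_eliminate\<close> removes \<open>y\<close>, the square of \<open>x\<close> is
  reduced, and a second elimination removes \<open>x\<close>.\<close>

lemma quadratic_lying_over:
  assumes E: "subring_of E" and P: "ideal_in E P"
    and x: "x * x = a * x + b" "a \<in> E" "b \<in> E"
    and y: "y * y = c * y + d" "c \<in> E" "d \<in> E"
    and pqr: "p \<in> P" "q \<in> P" "r \<in> P" "p + q * x + r * y = 1"
  shows "1 \<in> P"
proof -
  note i = ideal_inD[OF P] and e = subring_ofD[OF E]
  have pE: "p \<in> E" "q \<in> E" "r \<in> E" using pqr i(1) by auto
  have "1 = (p + q * x) + r * y" using pqr by simp
  from quadratic_eliminate[OF this y(1)]
  have eq: "1 = 2 * (p + q * x) - (p + q * x) * (p + q * x) + r * c * (1 - (p + q * x)) + r * r * d" .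
  have "(p + q * x) * (p + q * x) = p * p + 2 * p * q * x + q * q * (x * x)"
    by (simp add: algebra_simps)
  also have "\<dots> = (p * p + q * q * b) + (2 * p * q + q * q * a) * x"
    by (simp add: x(1) algebra_simps)
  finally have sq: "(p + q * x) * (p + q * x) = (p * p + q * q * b) + (2 * p * q + q * q * a) * x" .
  \<comment> \<open>These are the constant term and the \<open>x\<close>-coefficient of the first
    elimination. Writing \<open>p + p\<close> instead of \<open>2 * p\<close> makes every summand a
    product with a factor visibly in \<open>P\<close>.\<close>
  define p' where "p' = (p + p) - (p * p + q * q * b) + (r * c - r * c * p) + r * r * d"
  define q' where "q' = (q + q) - (p * q + p * q + q * q * a) - r * c * q"
  have one: "1 = p' + q' * x"
    using eq unfolding sq p'_def q'_def by (simp add: algebra_simps)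
  note idiff = ideal_diff[OF E P]
  have "p' \<in> P" "q' \<in> P"
    unfolding p'_def q'_def
    by (intro idiff i(3) i(5) pqr(1-3) pE x(2,3) y(2,3))+
  moreover have "p' \<in> E" "q' \<in> E" using calculation i(1) by auto
  moreover have "1 = (p' + p') - p' * p' + (q' * a - q' * a * p') + q' * q' * b"
    using quadratic_eliminate[OF one x(1)] by (simp add: algebra_simps)
  moreover have "(p' + p') - p' * p' + (q' * a - q' * a * p') + q' * q' * b \<in> P"
    by (intro idiff i(3) i(5) x(2,3) calculation(1-4))
  ultimately show ?thesis by simp
qed

section \<open>The finitely stable local ring and its quadratic overrings\<close>

locale finitely_stable_local =
  fixes R M :: "'a::comm_ring_1 set"
  assumes total: "total_quotient_ring R"
    and local: "local_ring R"
    and M_max: "maximal_ideal R M"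
    and fin_stable: "finitely_stable R"
    and M_regular: "regular M"
    and M_stable: "stable M"
begin

lemma R_subring: "subring_of R"
  using total by (simp add: total_quotient_ring_def)

lemma M_unique: "maximal_ideal R N \<Longrightarrow> N = M"
  using local M_max unfolding local_ring_def by blast

lemma M_ideal: "ideal_in R M"
  using M_max by (simp add: maximal_ideal_def)

lemma R_unit:
  assumes "r \<in> R" "r \<notin> M"
  shows "\<exists>t\<in>R. r * t = 1"
  by (rule unit_if_not_in_maximal_ideals[OF R_subring assms(1)]) (use assms(2) M_unique in blast)

lemma mult_in_span3_of_quadratic:
  assumes "quadratic_over R x" "quadratic_over R y"
  shows "x * y \<in> span3 R x y 1"
proof -
  let ?I = "span3 R x y 1"
  note I = span3_submodule[OF R_subring, where x = x and y = y and w = 1]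
  note E = Endo_subring[OF R_subring I(1)]
  have "regular ?I" unfolding regular_def by (intro bexI[OF _ I(4)]) simp
  then obtain p q r where pqr: "p * x + q * y + r * 1 = 1"
    "\<And>u. u \<in> ?I \<Longrightarrow> p * u \<in> Endo ?I" "\<And>u. u \<in> ?I \<Longrightarrow> q * u \<in> Endo ?I"
    "\<And>u. u \<in> ?I \<Longrightarrow> r * u \<in> Endo ?I"
    using finitely_stable_span3[OF total fin_stable] by blast
  \<comment> \<open>The inverse of \<open>?I\<close> over \<open>Endo ?I\<close>; it is contained in
    \<open>Endo ?I\<close> because 1 lies in \<open>?I\<close>.\<close>
  let ?P = "{z. \<forall>u\<in>?I. z * u \<in> Endo ?I}"
  have "ideal_in (Endo ?I) ?P"
    unfolding ideal_in_def
  proof (intro conjI ballI subsetI)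
    show "z \<in> Endo ?I" if "z \<in> ?P" for z using that I(4) by force
    show "0 \<in> ?P" using subring_ofD(1)[OF E(1)] by simp
    show "z + z' \<in> ?P" if "z \<in> ?P" "z' \<in> ?P" for z z'
      using that subring_ofD(3)[OF E(1)] by (simp add: distrib_right)
    show "e * z \<in> ?P" if "e \<in> Endo ?I" "z \<in> ?P" for e z
      using that subring_ofD(4)[OF E(1)] by (simp add: mult.assoc)
  qed
  moreover obtain a b where "a \<in> R" "b \<in> R" "x * x = a * x + b"
    using assms(1) by (auto simp: quadratic_over_def)
  moreover obtain c d where "c \<in> R" "d \<in> R" "y * y = c * y + d"
    using assms(2) by (auto simp: quadratic_over_def)
  moreover have "r + p * x + q * y = 1" using pqr(1) by (simp add: algebra_simps)
  moreover have "p \<in> ?P" "q \<in> ?P" "r \<in> ?P" using pqr(2-4) by auto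
  ultimately have "1 \<in> ?P"
    using quadratic_lying_over[OF E(1), of ?P x a b y c d r p q] E(2) by blast
  \<comment> \<open>That 1 lies in \<open>?P\<close> means that every element of \<open>?I\<close>
    multiplies \<open>?I\<close> into itself.\<close>
  then have "y \<in> Endo ?I" using I(3) by force
  then show ?thesis using I(2) by (auto simp: Endo_def mult.commute)
qed

text \<open>Only squares are constrained: this can be checked one element at a time and passes to
  increasing unions, and \<open>quadratic_overring_ext\<close> recovers the condition on all
  products.\<close>

definition quadratic_overring :: "'a set \<Rightarrow> bool" where
  "quadratic_overring S \<longleftrightarrow> subring_of S \<and> R \<subseteq> S \<and> (\<forall>x\<in>S. quadratic_over R x)"

lemma quadratic_overringD:
  assumes "quadratic_overring S"
  shows "subring_of S" "R \<subseteq> S" "x \<in> S \<Longrightarrow> \<exists>a\<in>R. \<exists>b\<in>R. x * x = a * x + b"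
  using assms by (auto simp: quadratic_overring_def quadratic_over_def)

lemma quadratic_overring_ext:
  assumes "quadratic_overring S"
  shows "quadratic_ext R S"
  unfolding quadratic_ext_def
proof (intro conjI ballI)
  show "R \<subseteq> S" using quadratic_overringD(2)[OF assms] .
  fix x y assume "x \<in> S" "y \<in> S"
  then have "x * y \<in> span3 R x y 1"
    using assms mult_in_span3_of_quadratic by (auto simp: quadratic_overring_def)
  then obtain a b c where "a \<in> R" "b \<in> R" "c \<in> R" "x * y = a * x + b * y + c * 1"
    by (rule span3E)
  then show "\<exists>a\<in>R. \<exists>b\<in>R. \<exists>c\<in>R. x * y = x * a + y * b + c"
    by (auto simp: mult.commute)
qed

section \<open>Maximal ideals of quadratic overrings\<close>

lemma maximal_ideal_inter_R:
  assumes S: "subring_of S" "R \<subseteq> S" "maximal_ideal S N" and r: "r \<in> R" "r \<in> N"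
  shows "r \<in> M"
proof (rule ccontr)
  assume "r \<notin> M"
  then obtain t where "t \<in> R" "r * t = 1" using R_unit r(1) by blast
  moreover have "ideal_in S N" using S(3) by (simp add: maximal_ideal_def)
  ultimately have "1 \<in> N" using ideal_inD(5)[of S N t r] r(2) S(2) by auto
  then show False using maximal_ideal_one[OF S(1,3)] by simp
qed

text \<open>If \<open>m\<close> in \<open>M\<close> avoided \<open>N\<close>, some
  \<open>m * s\<close> would be 1 modulo \<open>N\<close>. The norm of \<open>1 - m * s\<close>
  would then lie in \<open>N\<close> and in \<open>R\<close>, hence in \<open>M\<close>, although it
  is 1 modulo \<open>M\<close>.\<close>

lemma M_subset_maximal_ideal:
  assumes Q: "quadratic_overring S" and N: "maximal_ideal S N"
  shows "M \<subseteq> N"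
proof (rule ccontr)
  note S = quadratic_overringD[OF Q]
  note m_ideal = ideal_inD[OF M_ideal]
  have NI: "ideal_in S N" using N by (simp add: maximal_ideal_def)
  assume "\<not> M \<subseteq> N"
  then obtain m where m: "m \<in> M" "m \<notin> N" by blast
  then have mR: "m \<in> R" using m_ideal(1) by blast
  then have mS: "m \<in> S" using S(2) by blast
  obtain s where s: "s \<in> S" "1 - m * s \<in> N"
    using maximal_ideal_inverse[OF S(1) N mS m(2)] .
  obtain a b where ab: "a \<in> R" "b \<in> R" "s * s = a * s + b" using S(3) s(1) by blast
  \<comment> \<open>the norm of \<open>1 - m * s\<close> over \<open>R\<close>\<close>
  define v where "v = 1 - (m * a + m * (m * b))"
  have "v = (1 - m * s) * (1 - m * (a - s)) + m * m * (s * s - (a * s + b))"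
    by (simp add: v_def algebra_simps)
  then have "v = (1 - m * s) * (1 - m * (a - s))" using ab(3) by simp
  moreover have "1 - m * (a - s) \<in> S"
    by (intro subring_ofD(2,4,6)[OF S(1)] mS s(1) subsetD[OF S(2) ab(1)])
  ultimately have "v \<in> N" using s(2) ideal_inD(5)[OF NI] by blast
  moreover have z: "m * a + m * (m * b) \<in> M"
    by (intro m_ideal(3,5) m(1) subring_ofD(4)[OF R_subring] mR ab(1,2))
  have "v \<in> R" unfolding v_def
    by (intro subring_ofD(2,6)[OF R_subring] m_ideal(1)[OF z])
  ultimately have "v \<in> M" using maximal_ideal_inter_R[OF S(1,2) N] by simp
  then have "v + (m * a + m * (m * b)) \<in> M" using z m_ideal(3) by blast
  then show False using maximal_ideal_one[OF R_subring M_max] by (simp add: v_def)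
qed

text \<open>Modulo \<open>N1, N2, N3\<close> take \<open>x = (1, 1, 0)\<close> and \<open>y = (0, 1, 1)\<close>. Multiplying \<open>x\<close> and \<open>y\<close> shows that
  an endomorphism of \<open>R x + R y + R m\<close> is a scalar modulo \<open>N1 \<inter> N2 \<inter> N3\<close>; this makes every term of
  \<open>1 = p x + q y + r m\<close> vanish there, so this ideal cannot be stable.\<close>

lemma no_three_maximal_ideals:
  assumes Q: "quadratic_overring S"
    and N: "maximal_ideal S N1" "maximal_ideal S N2" "maximal_ideal S N3"
    and ne: "N1 \<noteq> N2" "N1 \<noteq> N3" "N2 \<noteq> N3"
  shows False
proof -
  note S = quadratic_overringD[OF Q]
  note ring = subring_ofD[OF S(1)]
  have I1: "ideal_in S N1" and I2: "ideal_in S N2" and I3: "ideal_in S N3"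
    using N by (auto simp: maximal_ideal_def)
  note i1 = ideal_inD[OF I1] and i2 = ideal_inD[OF I2] and i3 = ideal_inD[OF I3]
  note d1 = ideal_diff[OF S(1) I1] and d2 = ideal_diff[OF S(1) I2] and d3 = ideal_diff[OF S(1) I3]
  \<comment> \<open>Each of the three ideals meets \<open>R\<close> exactly in \<open>M\<close>, so
    for an element of \<open>R\<close> vanishing at one of them means vanishing at all.\<close>
  have into_all: "r \<in> N1" "r \<in> N2" "r \<in> N3" if "r \<in> R" "r \<in> N1 \<or> r \<in> N2 \<or> r \<in> N3" for r
    using that maximal_ideal_inter_R[OF S(1,2)] M_subset_maximal_ideal[OF Q] N by blast+
  have prod: "1 - g * h \<in> J" if "ideal_in S J" "1 - g \<in> J" "1 - h \<in> J" "g \<in> S" for g h J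
  proof -
    have "1 - g * h = (1 - g) + g * (1 - h)" by (simp add: algebra_simps)
    then show ?thesis using that ideal_inD(3,4) by metis
  qed
  obtain f1 where f1: "f1 \<in> N1" "1 - f1 \<in> N3" by (rule maximal_ideals_residues[OF S(1) N(3,1) ne(2)[symmetric]])
  obtain f2 where f2: "f2 \<in> N2" "1 - f2 \<in> N3" by (rule maximal_ideals_residues[OF S(1) N(3,2) ne(3)[symmetric]])
  obtain g2 where g2: "g2 \<in> N2" "1 - g2 \<in> N1" by (rule maximal_ideals_residues[OF S(1) N(1,2) ne(1)])
  obtain g3 where g3: "g3 \<in> N3" "1 - g3 \<in> N1" by (rule maximal_ideals_residues[OF S(1) N(1,3) ne(2)])
  have inS: "f1 \<in> S" "f2 \<in> S" "g2 \<in> S" "g3 \<in> S" using f1 f2 g2 g3 i1(1) i2(1) i3(1) by auto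
  \<comment> \<open>With residues listed at \<open>N1\<close>, \<open>N2\<close>, \<open>N3\<close>:
    \<open>f1 * f2\<close> is (0, 0, 1), so \<open>x\<close> is (1, 1, 0); \<open>e\<close> is (1,
    0, 0), so \<open>y = 1 - e * x\<close> is (0, 1, 1).\<close>
  define x where "x = 1 - f1 * f2"
  define e where "e = g2 * g3"
  define y where "y = 1 - e * x"
  have xS: "x \<in> S" and eS: "e \<in> S" and yS: "y \<in> S"
    unfolding x_def e_def y_def by (intro ring(2,4,6) inS)+
  have x1: "1 - x \<in> N1" and x2: "1 - x \<in> N2" and x3: "x \<in> N3"
    unfolding x_def using f1 f2 inS i1(5) i2(4) prod[OF I3] by auto
  have e1: "1 - e \<in> N1" and e2: "e \<in> N2" and e3: "e \<in> N3"
    unfolding e_def using g2 g3 inS i2(5) i3(4) prod[OF I1] by auto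
  have y1: "y \<in> N1" and y2: "1 - y \<in> N2" and y3: "1 - y \<in> N3"
    unfolding y_def using prod[OF I1 e1 x1 eS] e2 e3 xS i2(5) i3(5) by auto
  \<comment> \<open>Since \<open>y + e * x = 1\<close>, any element that multiplies both
    \<open>x\<close> and \<open>y\<close> into \<open>S\<close> lies in \<open>S\<close>.\<close>
  have xy: "z = z * y + e * (z * x)" for z by (simp add: y_def algebra_simps)
  \<comment> \<open>This generator makes the ideal regular while having residue 0 at all three
    maximal ideals.\<close>
  obtain m where m: "m \<in> M" "\<And>x. m * x = 0 \<Longrightarrow> x = 0" using M_regular by (auto simp: regular_def)
  have mR: "m \<in> R" using m(1) M_ideal ideal_inD(1) by blast
  then have mS: "m \<in> S" using S(2) by blast
  have mN: "m \<in> N1" "m \<in> N2" "m \<in> N3" using m(1) M_subset_maximal_ideal[OF Q] N by blast+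
  let ?I = "span3 R x y m"
  note I = span3_submodule[OF R_subring, where x = x and y = y and w = m]
  have IS: "u \<in> S" if u: "u \<in> ?I" for u
  proof -
    obtain a b c where "a \<in> R" "b \<in> R" "c \<in> R" "u = a * x + b * y + c * m"
      using u by (rule span3E)
    moreover from this have "a \<in> S" "b \<in> S" "c \<in> S" using S(2) by auto
    ultimately show ?thesis using xS yS mS ring(3,4) by simp
  qed
  have regI: "regular ?I" using m(2) I(4) by (auto simp: regular_def)
  have E_S: "u \<in> S" if "u * x \<in> S" "u * y \<in> S" for u
    using xy[of u] that eS ring(3,4) by metis
  \<comment> \<open>Reading \<open>u * x\<close> at \<open>N3\<close> kills \<open>b\<close>, and
    reading \<open>u * y\<close> at \<open>N1\<close> kills \<open>a'\<close>. Then \<open>u\<close>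
    agrees with \<open>a\<close> at \<open>N1\<close> and \<open>N2\<close>, and with
    \<open>b'\<close> at \<open>N2\<close> and \<open>N3\<close>. Comparison at \<open>N2\<close>
    shows that \<open>a\<close> and \<open>b'\<close> have the same residue everywhere.\<close>
  have scalar: "u \<in> S \<and> (\<exists>a\<in>R. u - a \<in> N1 \<and> u - a \<in> N2 \<and> u - a \<in> N3)" if u: "u \<in> Endo ?I" for u
  proof -
    have ux: "u * x \<in> ?I" and uy: "u * y \<in> ?I" using u I by (auto simp: Endo_def)
    have uS: "u \<in> S" using E_S ux uy IS by blast
    obtain a b c where abc: "a \<in> R" "b \<in> R" "c \<in> R" "u * x = a * x + b * y + c * m"
      using ux by (rule span3E)
    obtain a' b' c' where abc': "a' \<in> R" "b' \<in> R" "c' \<in> R" "u * y = a' * x + b' * y + c' * m"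
      using uy by (rule span3E)
    have rS: "a \<in> S" "b \<in> S" "c \<in> S" "a' \<in> S" "b' \<in> S" "c' \<in> S" using abc abc' S(2) by auto
    have "b = (u - a) * x + b * (1 - y) - c * m" using abc(4) by (simp add: algebra_simps)
    moreover have "(u - a) * x \<in> N3" using x3 uS rS ring(6) i3(4) by blast
    moreover have "b * (1 - y) \<in> N3" "c * m \<in> N3" using y3 mN rS i3(4) by blast+
    ultimately have "b \<in> N3" using d3 i3(3) by metis
    then have b: "b \<in> N1" "b \<in> N2" using into_all abc(2) by blast+
    have "a' = (u - b') * y + a' * (1 - x) - c' * m" using abc'(4) by (simp add: algebra_simps)
    moreover have "(u - b') * y \<in> N1" using y1 uS rS ring(6) i1(4) by blast
    moreover have "a' * (1 - x) \<in> N1" "c' * m \<in> N1" using x1 mN rS i1(4) by blast+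
    ultimately have "a' \<in> N1" using d1 i1(3) by metis
    then have a': "a' \<in> N2" "a' \<in> N3" using into_all abc'(1) by blast+
    have ua: "u - a = (u - a) * (1 - x) + (b * y + c * m)" using abc(4) by (simp add: algebra_simps)
    have ub: "u - b' = (u - b') * (1 - y) + (a' * x + c' * m)" using abc'(4) by (simp add: algebra_simps)
    have "u - a \<in> N1"
      by (subst ua, intro i1(3) i1(4) i1(5)[OF yS b(1)]) (use x1 mN uS rS ring(6) in auto)
    moreover have ua2: "u - a \<in> N2"
      by (subst ua, intro i2(3) i2(4) i2(5)[OF yS b(2)]) (use x2 mN uS rS ring(6) in auto)
    moreover have ub2: "u - b' \<in> N2"
      by (subst ub, intro i2(3) i2(4) i2(5)[OF xS a'(1)]) (use y2 mN uS rS ring(6) in auto)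
    have ub3: "u - b' \<in> N3"
      by (subst ub, intro i3(3) i3(4) i3(5)[OF xS a'(2)]) (use y3 mN uS rS ring(6) in auto)
    have "b' - a = (u - a) - (u - b')" by simp
    then have "b' - a \<in> N2" using d2[OF ua2 ub2] by simp
    then have "b' - a \<in> N3" using into_all abc(1) abc'(2) subring_ofD(6)[OF R_subring] by blast
    then have "(u - b') + (b' - a) \<in> N3" using ub3 i3(3) by blast
    ultimately show ?thesis using uS abc(1) by auto
  qed
  have vanish: "u \<in> N1"
    if u: "u \<in> Endo ?I" and uN: "u \<in> N1 \<or> u \<in> N3" for u
  proof -
    obtain a where a: "a \<in> R" "u - a \<in> N1" "u - a \<in> N3" using scalar[OF u] by blast
    have "a = u - (u - a)" by simp
    then have "a \<in> N1 \<or> a \<in> N3" using uN a d1 d3 by metis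
    then have "a \<in> N1" using into_all a(1) by blast
    then have "(u - a) + a \<in> N1" using a(2) i1(3) by blast
    then show ?thesis by simp
  qed
  obtain p q r where pqr: "p * x + q * y + r * m = 1"
    "\<And>u. u \<in> ?I \<Longrightarrow> p * u \<in> Endo ?I" "\<And>u. u \<in> ?I \<Longrightarrow> q * u \<in> Endo ?I"
    "\<And>u. u \<in> ?I \<Longrightarrow> r * u \<in> Endo ?I"
    using finitely_stable_span3[OF total fin_stable regI] by blast
  have dual_S: "u \<in> S" if "\<And>v. v \<in> ?I \<Longrightarrow> u * v \<in> Endo ?I" for u
    using that[OF I(2)] that[OF I(3)] scalar E_S by blast
  \<comment> \<open>All three terms lie in \<open>N1\<close>: \<open>p * x\<close> is an
    endomorphism vanishing at \<open>N3\<close>, hence at \<open>N1\<close> by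
    \<open>vanish\<close>, while \<open>y\<close> and \<open>m\<close> lie in \<open>N1\<close>
    themselves.\<close>
  have "p * x \<in> N3" by (rule i3(4)[OF dual_S[OF pqr(2)] x3])
  then have "p * x \<in> N1" using vanish pqr(2)[OF I(2)] by blast
  moreover have "q * y \<in> N1" by (rule i1(4)[OF dual_S[OF pqr(3)] y1])
  moreover have "r * m \<in> N1" by (rule i1(4)[OF dual_S[OF pqr(4)] mN(1)])
  ultimately have "1 \<in> N1" using pqr(1) i1(3) by metis
  then show False using maximal_ideal_one[OF S(1) N(1)] by simp
qed

section \<open>Endomorphism rings of Jacobson radicals\<close>

text \<open>Invert \<open>R x + R\<close>. If its endomorphism ring lies in \<open>S\<close>, then
  \<open>p * x\<close> or \<open>q\<close> is a unit of \<open>S\<close>; in the first case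
  \<open>p\<close> is a unit too, as \<open>x\<close> maps \<open>N\<close> into \<open>N\<close>,
  and both cases put \<open>x\<close> in \<open>S\<close>. Otherwise some endomorphism
  \<open>b * x + a\<close> lies outside \<open>S\<close>. Then \<open>b\<close> is a unit of
  \<open>R\<close>, since \<open>M\<close> multiplies \<open>x\<close> into \<open>N\<close>, so
  \<open>x\<close> is itself an endomorphism and \<open>x * x\<close> lies in
  \<open>R x + R\<close>.\<close>

lemma Endo_unique_maximal_quadratic:
  assumes Q: "quadratic_overring S" and N: "maximal_ideal S N"
    and uniq: "\<And>N'. maximal_ideal S N' \<Longrightarrow> N' = N"
    and x: "x \<in> Endo N"
  shows "quadratic_over R x"
proof -
  note S = quadratic_overringD[OF Q]
  note ring = subring_ofD[OF S(1)]
  have NI: "ideal_in S N" using N by (simp add: maximal_ideal_def)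
  have xN: "x * n \<in> N" "n * x \<in> N" if "n \<in> N" for n using x that by (auto simp: Endo_def mult.commute)
  have unit: "\<exists>t\<in>S. u * t = 1" if "u \<in> S" "u \<notin> N" for u
    by (rule unit_if_not_in_maximal_ideals[OF S(1) that(1)]) (use that(2) uniq in blast)
  let ?I = "span3 R x 1 0"
  note I = span3_submodule[OF R_subring, where x = x and y = 1 and w = 0]
  note E = Endo_subring[OF R_subring I(1)]
  have "regular ?I" unfolding regular_def by (intro bexI[OF _ I(3)]) simp
  then obtain p q r where pqr: "p * x + q * 1 + r * 0 = 1"
    "\<And>u. u \<in> ?I \<Longrightarrow> p * u \<in> Endo ?I" "\<And>u. u \<in> ?I \<Longrightarrow> q * u \<in> Endo ?I"
    "\<And>u. u \<in> ?I \<Longrightarrow> r * u \<in> Endo ?I"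
    using finitely_stable_span3[OF total fin_stable] by blast
  have in_E: "p * x \<in> Endo ?I" "p \<in> Endo ?I" "q * x \<in> Endo ?I" "q \<in> Endo ?I"
    using pqr(2)[OF I(2)] pqr(2)[OF I(3)] pqr(3)[OF I(2)] pqr(3)[OF I(3)] by simp_all
  have E_I: "e \<in> ?I" if "e \<in> Endo ?I" for e using that I(3) by (force simp: Endo_def)
  have "x \<in> S \<or> x \<in> Endo ?I"
  proof (cases "Endo ?I \<subseteq> S")
    case True
    then have inS: "p * x \<in> S" "p \<in> S" "q * x \<in> S" "q \<in> S" using in_E by auto
    have "p * x \<notin> N \<or> q \<notin> N"
      using pqr(1) ideal_inD(3)[OF NI] maximal_ideal_one[OF S(1) N] by force
    then show ?thesis
    proof
      assume px: "p * x \<notin> N"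
      then have "p \<notin> N" using xN by blast
      then obtain t where "t \<in> S" "p * t = 1" using unit inS by blast
      then have "x = t * (p * x)" by (metis mult.assoc mult.commute mult_1)
      then show ?thesis using \<open>t \<in> S\<close> inS(1) ring(4) by metis
    next
      assume "q \<notin> N"
      then obtain t where "t \<in> S" "q * t = 1" using unit inS by blast
      then have "x = t * (q * x)" by (metis mult.assoc mult.commute mult_1)
      then show ?thesis using \<open>t \<in> S\<close> inS(3) ring(4) by metis
    qed
  next
    case False
    then obtain e where e: "e \<in> Endo ?I" "e \<notin> S" by blast
    then obtain b a c where abc: "b \<in> R" "a \<in> R" "c \<in> R" "e = b * x + a * 1 + c * 0"
      using E_I span3E by metis
    have "b \<notin> M"
    proof
      assume "b \<in> M"
      then have "b * x \<in> S" using M_subset_maximal_ideal[OF Q N] xN ideal_inD(1)[OF NI] by blast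
      then show False using abc e(2) S(2) ring(3) by auto
    qed
    then obtain t where t: "t \<in> R" "b * t = 1" using R_unit abc(1) by blast
    have "e - a = b * x" using abc(4) by simp
    then have "t * (e - a) = (b * t) * x" by (simp add: ac_simps)
    moreover have "t * (e - a) \<in> Endo ?I"
      by (intro subring_ofD(4,6)[OF E(1)] e(1) subsetD[OF E(2)] t(1) abc(2))
    ultimately show ?thesis using t(2) by simp
  qed
  then show ?thesis
  proof
    assume "x \<in> S" then show ?thesis using Q by (simp add: quadratic_overring_def)
  next
    assume "x \<in> Endo ?I"
    then have "x * x \<in> ?I" using I(2) by (simp add: Endo_def)
    then obtain a b c where "a \<in> R" "b \<in> R" "x * x = a * x + b * 1 + c * 0" by (rule span3E)
    then show ?thesis by (auto simp: quadratic_over_def)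
  qed
qed

text \<open>The set \<open>K\<close> below is the ideal \<open>M S\<close>, described through the inverse of \<open>M\<close> over \<open>Endo M\<close>. In the
  presence of two maximal ideals it turns out to be the whole Jacobson radical, an invertible ideal.\<close>

lemma Endo_two_maximal:
  assumes Q: "quadratic_overring S" and M_S: "Endo M \<subseteq> S"
    and N: "maximal_ideal S N1" "maximal_ideal S N2" "N1 \<noteq> N2"
    and all: "\<And>N. maximal_ideal S N \<Longrightarrow> N = N1 \<or> N = N2"
  shows "Endo (N1 \<inter> N2) \<subseteq> S"
proof -
  note S = quadratic_overringD[OF Q]
  note ring = subring_ofD[OF S(1)]
  have I1: "ideal_in S N1" and I2: "ideal_in S N2"
    using N by (auto simp: maximal_ideal_def)
  note i1 = ideal_inD[OF I1] and i2 = ideal_inD[OF I2]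
  note d1 = ideal_diff[OF S(1) I1] and d2 = ideal_diff[OF S(1) I2]
  note one1 = maximal_ideal_one[OF S(1) N(1)] and one2 = maximal_ideal_one[OF S(1) N(2)]
  have unit: "\<exists>t\<in>S. u * t = 1" if "u \<in> S" "u \<notin> N1" "u \<notin> N2" for u
    by (rule unit_if_not_in_maximal_ideals[OF S(1) that(1)]) (use that all in blast)
  define K where "K = {z \<in> S. \<forall>b. (\<forall>u\<in>M. b * u \<in> Endo M) \<longrightarrow> b * z \<in> S}"
  have K: "ideal_in S K"
    unfolding ideal_in_def K_def
    using ring(1,3,4) by (auto simp: distrib_left mult.left_commute)
  note k = ideal_inD[OF K] and dK = ideal_diff[OF S(1) K]
  have MK: "M \<subseteq> K"
    using M_S S(2) ideal_inD(1)[OF M_ideal] by (auto simp: K_def)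
  \<comment> \<open>An element with residues (1, 0) at \<open>N1\<close>, \<open>N2\<close> is
    idempotent modulo \<open>K\<close>: in \<open>w * w = a * w + b\<close>, reduction at
    \<open>N2\<close> puts \<open>b\<close> in \<open>M\<close>, and then reduction at
    \<open>N1\<close> puts \<open>1 - a\<close> in \<open>M\<close>.\<close>
  have idem: "w * w - w \<in> K" if w: "w \<in> N2" "1 - w \<in> N1" for w
  proof -
    have wS: "w \<in> S" using w(1) i2(1) by blast
    obtain a b where ab: "a \<in> R" "b \<in> R" "w * w = a * w + b" using S(3) wS by blast
    have aS: "a \<in> S" using ab(1) S(2) by blast
    have "b = w * w - a * w" using ab(3) by simp
    moreover have "w * w - a * w \<in> N2" using w(1) wS aS d2 i2(4) by blast
    ultimately have b: "b \<in> M" using maximal_ideal_inter_R[OF S(1,2) N(2) ab(2)] by simp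
    have "1 - a = b + (1 - w) * (1 + w - a)" using ab(3) by (simp add: algebra_simps)
    moreover have "b \<in> N1" using b M_subset_maximal_ideal[OF Q N(1)] by blast
    moreover have "(1 - w) * (1 + w - a) \<in> N1" by (intro i1(5) w(2) ring(2,3,6) wS aS)
    ultimately have "1 - a \<in> N1" using i1(3) by metis
    moreover have "1 - a \<in> R" by (intro subring_ofD(2,6)[OF R_subring] ab(1))
    ultimately have "1 - a \<in> M" using maximal_ideal_inter_R[OF S(1,2) N(1)] by simp
    then have "b - (1 - a) * w \<in> K" by (intro dK k(5) wS subsetD[OF MK] b)
    moreover have "w * w - w = b - (1 - a) * w" using ab(3) by (simp add: algebra_simps)
    ultimately show ?thesis by simp
  qed
  \<comment> \<open>Let \<open>z * z = c * z + d\<close>; then \<open>d\<close> is in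
    \<open>M\<close>. If \<open>c\<close> is a unit, so is \<open>z - c\<close>, and
    \<open>z * (z - c) = d\<close> is in \<open>K\<close>. If \<open>c\<close> is in
    \<open>M\<close>, then \<open>z * z\<close> is in \<open>K\<close>; as \<open>e\<close> and
    \<open>z + e\<close> are both idempotent modulo \<open>K\<close>, so is
    \<open>z * (e + e - 1)\<close>, whose second factor is a unit with residues 1 and -1.\<close>
  have J_K: "z \<in> K" if z: "z \<in> N1" "z \<in> N2" for z
  proof -
    have zS: "z \<in> S" using z i1(1) by blast
    obtain c d where cd: "c \<in> R" "d \<in> R" "z * z = c * z + d" using S(3) zS by blast
    have cS: "c \<in> S" using cd(1) S(2) by blast
    have "d = z * z - c * z" using cd(3) by simp
    moreover have "z * z - c * z \<in> N1" using z zS cS d1 i1(4) by blast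
    ultimately have dM: "d \<in> M" using maximal_ideal_inter_R[OF S(1,2) N(1) cd(2)] by simp
    show ?thesis
    proof (cases "c \<in> M")
      case False
      have c_not: "c \<notin> N1" "c \<notin> N2" using False cd(1) maximal_ideal_inter_R[OF S(1,2)] N by blast+
      have c_eq: "c = z - (z - c)" by simp
      have "z - c \<notin> N1" using c_not(1) c_eq d1[OF z(1)] by metis
      moreover have "z - c \<notin> N2" using c_not(2) c_eq d2[OF z(2)] by metis
      ultimately obtain t where t: "t \<in> S" "(z - c) * t = 1" using unit[OF ring(6)[OF zS cS]] by blast
      have "z = z * ((z - c) * t)" using t(2) by simp
      also have "\<dots> = (z * z - c * z) * t" by (simp add: algebra_simps)
      also have "\<dots> = d * t" using cd(3) by simp
      finally show ?thesis using dM MK t(1) k(5) by auto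
    next
      case True
      have zz: "z * z \<in> K"
        unfolding cd(3) by (intro k(3,5) zS subsetD[OF MK] True dM)
      obtain e where e: "e \<in> N2" "1 - e \<in> N1" using maximal_ideals_residues[OF S(1) N] .
      have eS: "e \<in> S" using e i2(1) by blast
      have ee: "e * e - e \<in> K" using idem e by blast
      have "1 - (z + e) = (1 - e) - z" by simp
      then have "1 - (z + e) \<in> N1" using d1[OF e(2) z(1)] by metis
      then have ww: "(z + e) * (z + e) - (z + e) \<in> K" using idem z e i2(3) by blast
      have "z * (e + e - 1) = ((z + e) * (z + e) - (z + e)) - z * z - (e * e - e)"
        by (simp add: algebra_simps)
      then have ze: "z * (e + e - 1) \<in> K" using ww zz ee dK by metis
      have "e + e - 1 \<notin> N1"
      proof
        assume "e + e - 1 \<in> N1"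
        then have "(e + e - 1) + ((1 - e) + (1 - e)) \<in> N1" using e(2) i1(3) by blast
        then show False using one1 by (simp add: algebra_simps)
      qed
      moreover have "e + e - 1 \<notin> N2"
      proof
        assume "e + e - 1 \<in> N2"
        then have "(e + e) - (e + e - 1) \<in> N2" using e(1) i2(3) d2 by blast
        then show False using one2 by simp
      qed
      ultimately obtain t where t: "t \<in> S" "(e + e - 1) * t = 1" 
        using unit[OF ring(6)[OF ring(3)[OF eS eS] ring(2)]] by blast
      have "z = (z * (e + e - 1)) * t" using t(2) by (simp only: mult.assoc mult_1_right)
      then show ?thesis using ze t(1) k(5) by metis
    qed
  qed
  obtain F b where F: "finite F" "F \<subseteq> M" "\<And>z u. u \<in> M \<Longrightarrow> b z * u \<in> Endo M" "(\<Sum>z\<in>F. b z * z) = 1"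
    using stable_regular_invertible[OF total ideal_in_submodule[OF M_ideal] M_regular M_stable] by blast
  show ?thesis
  proof
    \<comment> \<open>Expand \<open>q\<close> as the sum of the terms \<open>b z * (q * z)\<close>.
      Each \<open>z\<close> in \<open>F\<close> lies in both maximal ideals, so \<open>q * z\<close>
      does too and hence lies in \<open>K\<close>, which \<open>b z\<close> multiplies into
      \<open>S\<close>.\<close>
    fix q assume q: "q \<in> Endo (N1 \<inter> N2)"
    have "b z * (q * z) \<in> S" if "z \<in> F" for z
    proof -
      have "z \<in> N1 \<inter> N2" using that F(2) M_subset_maximal_ideal[OF Q] N by blast
      then have "q * z \<in> K" using q J_K by (auto simp: Endo_def)
      then show ?thesis using F(3) by (auto simp: K_def)
    qed
    then have "(\<Sum>z\<in>F. b z * (q * z)) \<in> S" by (rule subring_sum[OF S(1)])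
    also have "(\<Sum>z\<in>F. b z * (q * z)) = q * (\<Sum>z\<in>F. b z * z)"
      by (subst sum_distrib_left) (simp add: ac_simps)
    finally show "q \<in> S" using F(4) by simp
  qed
qed

section \<open>The chain of the rings \<open>R_seq R i\<close> and its union\<close>

lemma jac_R: "jac R = M"
proof -
  have "maximal_ideal R N \<longleftrightarrow> N = M" for N using M_unique M_max by blast
  moreover have "M \<subseteq> R" using M_ideal by (simp add: ideal_in_def)
  ultimately show ?thesis by (auto simp: jac_def)
qed

text \<open>The induction step along the chain. The alternative on \<open>S\<close> supplies what
  \<open>Endo_two_maximal\<close> requires: two maximal ideals exclude \<open>S = R\<close>, and all
  later rings contain \<open>Endo M\<close>.\<close>

lemma Endo_jac_quadratic_overring:
  assumes Q: "quadratic_overring S" and "S = R \<or> Endo M \<subseteq> S"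
  shows "S \<subseteq> Endo (jac S)" "quadratic_overring (Endo (jac S))" "Endo M \<subseteq> Endo (jac S)"
proof -
  note S = quadratic_overringD[OF Q]
  note E = Endo_subring[OF S(1) ideal_in_submodule[OF jac_ideal[OF S(1)]]]
  show "S \<subseteq> Endo (jac S)" by (rule E(2))
  then show "Endo M \<subseteq> Endo (jac S)" using assms(2) jac_R by auto
  have "(0::'a) \<noteq> 1"
    using maximal_ideal_one[OF R_subring M_max] ideal_inD(2)[OF M_ideal] by auto
  then obtain N1 where N1: "maximal_ideal S N1"
    using nonunit_in_maximal_ideal[OF S(1) subring_ofD(1)[OF S(1)]] by auto
  have sub: "N \<subseteq> S" if "maximal_ideal S N" for N
    using that by (simp add: maximal_ideal_def ideal_in_def)
  have "quadratic_over R x" if x: "x \<in> Endo (jac S)" for x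
  proof (cases "\<forall>N. maximal_ideal S N \<longrightarrow> N = N1")
    case True
    then have "maximal_ideal S N \<longleftrightarrow> N = N1" for N using N1 by blast
    then have "jac S = N1" using sub[OF N1] by (auto simp: jac_def)
    then show ?thesis using Endo_unique_maximal_quadratic[OF Q N1] True x by blast
  next
    case False
    then obtain N2 where N2: "maximal_ideal S N2" "N1 \<noteq> N2" by blast
    have all: "N = N1 \<or> N = N2" if "maximal_ideal S N" for N
      using no_three_maximal_ideals[OF Q N1 N2(1) that] N2(2) by blast
    have "S \<noteq> R" using False M_unique N1 by blast
    then have "Endo M \<subseteq> S" using assms(2) by blast
    have "maximal_ideal S N \<longleftrightarrow> N = N1 \<or> N = N2" for N using N1 N2(1) all by blast
    then have "jac S = N1 \<inter> N2" using sub[OF N1] by (auto simp: jac_def)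
    moreover have "Endo (N1 \<inter> N2) \<subseteq> S"
      by (rule Endo_two_maximal[OF Q \<open>Endo M \<subseteq> S\<close> N1 N2]) (rule all)
    ultimately have "x \<in> S" using x by auto
    then show ?thesis using Q by (simp add: quadratic_overring_def)
  qed
  then show "quadratic_overring (Endo (jac S))"
    using E S(2) by (auto simp: quadratic_overring_def)
qed

lemma R_quadratic_overring: "quadratic_overring R"
proof -
  have "quadratic_over R x" if "x \<in> R" for x
    unfolding quadratic_over_def
    by (intro bexI[OF _ that] bexI[OF _ subring_ofD(1)[OF R_subring]]) simp
  then show ?thesis using R_subring by (simp add: quadratic_overring_def)
qed

lemma R_seq_quadratic_overring:
  "quadratic_overring (R_seq R i) \<and> (R_seq R i = R \<or> Endo M \<subseteq> R_seq R i)"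
proof (induction i)
  case 0
  show ?case using R_quadratic_overring by simp
next
  case (Suc i)
  then show ?case using Endo_jac_quadratic_overring by simp
qed

lemma R_seq_mono: "i \<le> j \<Longrightarrow> R_seq R i \<subseteq> R_seq R j"
  by (rule lift_Suc_mono_le) (use R_seq_quadratic_overring Endo_jac_quadratic_overring(1) in auto)

lemma R_inf_quadratic_overring: "quadratic_overring (R_inf R)"
proof -
  have Q: "quadratic_overring (R_seq R i)" for i using R_seq_quadratic_overring by blast
  note ring = subring_ofD[OF quadratic_overringD(1)[OF Q]]
  \<comment> \<open>The union in \<open>R_inf\<close> starts at index 1; passing to
    \<open>Suc i\<close> takes care of \<open>R_seq R 0\<close>.\<close>
  have memI: "x \<in> R_inf R" if "x \<in> R_seq R i" for x i
  proof -
    have "x \<in> R_seq R (Suc i)" using that R_seq_mono[of i "Suc i"] by auto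
    then show ?thesis unfolding R_inf_def by (intro UN_I[of "Suc i"]) auto
  qed
  have memE: "\<exists>i. x \<in> R_seq R i \<and> y \<in> R_seq R i" if xy: "x \<in> R_inf R" "y \<in> R_inf R" for x y
  proof -
    obtain i j where "x \<in> R_seq R i" "y \<in> R_seq R j" using xy by (auto simp: R_inf_def)
    then have "x \<in> R_seq R (max i j)" "y \<in> R_seq R (max i j)"
      using R_seq_mono[of i "max i j"] R_seq_mono[of j "max i j"] by auto
    then show ?thesis by blast
  qed
  have "subring_of (R_inf R)"
    unfolding subring_of_def
  proof (intro conjI ballI)
    show "0 \<in> R_inf R" "1 \<in> R_inf R" using memI ring(1,2) by blast+
    show "x + y \<in> R_inf R" "x * y \<in> R_inf R" if "x \<in> R_inf R" "y \<in> R_inf R" for x y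
      using memE[OF that] memI ring(3,4) by blast+
    show "- x \<in> R_inf R" if "x \<in> R_inf R" for x
      using memE[OF that that] memI ring(5) by blast
  qed
  moreover have "R \<subseteq> R_inf R" using memI[of _ 0] by auto
  moreover have "quadratic_over R x" if "x \<in> R_inf R" for x
    using memE[OF that that] Q by (auto simp: quadratic_overring_def)
  ultimately show ?thesis by (simp add: quadratic_overring_def)
qed

text \<open>Since \<open>card\<close> of an infinite set is 0, finiteness is part of the claim. If
  the claim fails, three distinct maximal ideals can be picked in either case.\<close>

lemma R_inf_maximal_ideals:
  "finite {N. maximal_ideal (R_inf R) N} \<and> card {N. maximal_ideal (R_inf R) N} \<le> 2"
proof (rule ccontr)
  let ?A = "{N. maximal_ideal (R_inf R) N}"
  assume *: "\<not> (finite ?A \<and> card ?A \<le> 2)"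
  have "\<exists>B. B \<subseteq> ?A \<and> card B = 3"
  proof (cases "finite ?A")
    case True
    then have "3 \<le> card ?A" using * by simp
    then show ?thesis using obtain_subset_with_card_n by metis
  next
    case False
    then show ?thesis using infinite_arbitrarily_large by blast
  qed
  then obtain N1 N2 N3 where "{N1, N2, N3} \<subseteq> ?A" "N1 \<noteq> N2" "N1 \<noteq> N3" "N2 \<noteq> N3"
    by (auto simp: card_3_iff)
  then show False using no_three_maximal_ideals[OF R_inf_quadratic_overring] by auto
qed

lemma R_quadratic_ring: "quadratic_ring R"
  unfolding quadratic_ring_def
  using local M_unique M_regular M_stable quadratic_overring_ext[OF R_inf_quadratic_overring] by blast

end

theorem theorem3p9:
  fixes R M :: "'a::comm_ring_1 set"
  assumes "total_quotient_ring R"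
    and "local_ring R"
    and "maximal_ideal R M"
    and "finitely_stable R"
    and "regular M"
    and "stable M"
  shows "quadratic_ring R \<and> finite {N. maximal_ideal (R_inf R) N}
         \<and> card {N. maximal_ideal (R_inf R) N} \<le> 2"
proof -
  interpret finitely_stable_local R M
    using assms by unfold_locales
  show ?thesis using R_quadratic_ring R_inf_maximal_ideals by blast
qed

end
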